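(* Let $G$ and $H$ be connected graphs on $n$ vertices. If $G\geq_e H$ then $\alpha(G)\geq \alpha(H)$.
   Context: All graphs are finite and simple. $\alpha(G)$ is the independence number of $G$ (the maximum size of a set of pairwise non-adjacent vertices). The chromatic symmetric function of a graph $G$ with vertices $v_1,\dots,v_n$ is $X_G=\sum_{\kappa}x_{\kappa(v_1)}\cdots x_{\kappa(v_n)}$, summed over all proper colorings $\kappa:V(G)\to\{1,2,3,\dots\}$; it is a homogeneous symmetric function of degree $n$ over $\mathbb{Q}$. Let $e_\lambda=e_{\lambda_1}e_{\lambda_2}\cdots$ be the elementary symmetric functions; $[e_\lambda]F$ denotes the coefficient of $e_\lambda$ in $F$ expanded in this basis, and $F$ is $e$-positive if $[e_\lambda]F\ge 0$ for all $\lambda$. For connected graphs $G,H$ on $n$ vertices (for which $[e_{(n)}]X_G$ and $[e_{(n)}]X_H$ are positive), set $$X_e(G,H)=X_G-\frac{[e_{(n)}]X_G}{[e_{(n)}]X_H}X_H,$$ and write $G\geq_e H$ if $X_e(G,H)$ is $e$-positive. *)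

theory Defs
  imports
    "HOL-Library.Multiset"
    "HOL-Library.FuncSet"
    "Graph_Theory.Graph_Theory"
begin

section \<open>Formal power series in countably many variables\<close>

text \<open>
  The variables are indexed by \<open>0, 1, 2, \<dots>\<close> (rather than \<open>1, 2, 3, \<dots>\<close>), and a monomial is the
  finite multiset of the indices of its variables: \<open>{#0, 0, 3#}\<close> stands for
  \<open>x\<^sub>0 x\<^sub>0 x\<^sub>3\<close>.  A series is its family of coefficients, so series of unbounded degree are
  included; symmetric functions form a subring.
\<close>

typedef 'a mvps = "UNIV :: (nat multiset \<Rightarrow> 'a) set"
  morphisms mvps_coeff Abs_mvps
  by simp

setup_lifting type_definition_mvps

lemma mvps_eqI: "(\<And>m. mvps_coeff F m = mvps_coeff G m) \<Longrightarrow> F = G"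
  by transfer auto

lemma finite_mset_splits [simp]: "finite {(a, b). a + b = (m :: 'b multiset)}"
proof (induction m)
  case empty
  have "{(a, b). a + b = ({#} :: 'b multiset)} = {({#}, {#})}"
    by auto
  then show ?case by simp
next
  case (add x m)
  let ?S = "{(a, b). a + b = m}"
  have "(a, b) \<in> (\<lambda>(a, b). (add_mset x a, b)) ` ?S \<union> (\<lambda>(a, b). (a, add_mset x b)) ` ?S"
    if *: "a + b = add_mset x m" for a b
  proof -
    from * have "x \<in># a + b" by simp
    then consider a' where "a = add_mset x a'" | b' where "b = add_mset x b'"
      by (auto dest: multi_member_split)
    then show ?thesis
      using * by cases (auto simp: image_iff)
  qed
  then have "{(a, b). a + b = add_mset x m} \<subseteq>
      (\<lambda>(a, b). (add_mset x a, b)) ` ?S \<union> (\<lambda>(a, b). (a, add_mset x b)) ` ?S"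
    by auto
  then show ?case
    using add.IH by (meson finite_UnI finite_imageI finite_subset)
qed

instantiation mvps :: (comm_ring_1) comm_ring_1
begin

lift_definition zero_mvps :: "'a mvps" is "\<lambda>m. 0" .

lift_definition one_mvps :: "'a mvps" is "\<lambda>m. if m = {#} then 1 else 0" .

lift_definition plus_mvps :: "'a mvps \<Rightarrow> 'a mvps \<Rightarrow> 'a mvps" is "\<lambda>F G m. F m + G m" .

lift_definition minus_mvps :: "'a mvps \<Rightarrow> 'a mvps \<Rightarrow> 'a mvps" is "\<lambda>F G m. F m - G m" .

lift_definition uminus_mvps :: "'a mvps \<Rightarrow> 'a mvps" is "\<lambda>F m. - F m" .

lift_definition times_mvps :: "'a mvps \<Rightarrow> 'a mvps \<Rightarrow> 'a mvps"
  is "\<lambda>F G m. \<Sum>(a, b) | a + b = m. F a * G b" .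

instance
proof
  fix F G H :: "'a mvps"
  show "F * G * H = F * (G * H)"
  proof transfer
    fix F G H :: "nat multiset \<Rightarrow> 'a"
    show "(\<lambda>m. \<Sum>(a, b) | a + b = m. (\<Sum>(c, d) | c + d = a. F c * G d) * H b) =
          (\<lambda>m. \<Sum>(a, b) | a + b = m. F a * (\<Sum>(c, d) | c + d = b. G c * H d))"
    proof
      fix m :: "nat multiset"
      let ?S = "\<lambda>m :: nat multiset. {(a, b). a + b = m}"
      have "(\<Sum>(a, b) | a + b = m. (\<Sum>(c, d) | c + d = a. F c * G d) * H b) =
            (\<Sum>p\<in>?S m. \<Sum>q\<in>?S (fst p). F (fst q) * G (snd q) * H (snd p))"
        by (simp add: sum_distrib_right case_prod_unfold)
      also have "\<dots> = (\<Sum>(p, q)\<in>Sigma (?S m) (\<lambda>p. ?S (fst p)). F (fst q) * G (snd q) * H (snd p))"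
        by (subst sum.Sigma) auto
      also have "\<dots> = (\<Sum>(p, q)\<in>Sigma (?S m) (\<lambda>p. ?S (snd p)). F (fst p) * (G (fst q) * H (snd q)))"
        by (rule sum.reindex_bij_witness
              [where j = "\<lambda>((a, b), (c, d)). ((c, d + b), (d, b))"
                 and i = "\<lambda>((a, b), (c, d)). ((a + c, d), (a, c))"])
           (auto simp: algebra_simps)
      also have "\<dots> = (\<Sum>p\<in>?S m. \<Sum>q\<in>?S (snd p). F (fst p) * (G (fst q) * H (snd q)))"
        by (subst sum.Sigma) auto
      also have "\<dots> = (\<Sum>(a, b) | a + b = m. F a * (\<Sum>(c, d) | c + d = b. G c * H d))"
        by (simp add: sum_distrib_left case_prod_unfold)
      finally show "(\<Sum>(a, b) | a + b = m. (\<Sum>(c, d) | c + d = a. F c * G d) * H b) =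
          (\<Sum>(a, b) | a + b = m. F a * (\<Sum>(c, d) | c + d = b. G c * H d))" .
    qed
  qed
  show "F * G = G * F"
  proof transfer
    fix F G :: "nat multiset \<Rightarrow> 'a"
    show "(\<lambda>m. \<Sum>(a, b) | a + b = m. F a * G b) = (\<lambda>m. \<Sum>(a, b) | a + b = m. G a * F b)"
      by (rule ext, rule sum.reindex_bij_witness[where i = prod.swap and j = prod.swap])
         (auto simp: algebra_simps)
  qed
  show "1 * F = F"
  proof transfer
    fix F :: "nat multiset \<Rightarrow> 'a"
    show "(\<lambda>m. \<Sum>(a, b) | a + b = m. (if a = {#} then 1 else 0) * F b) = F"
    proof
      fix m :: "nat multiset"
      have "(\<Sum>(a, b) | a + b = m. (if a = {#} then 1 else 0) * F b) =
            (\<Sum>(a, b)\<in>{({#} :: nat multiset, m)}. (if a = {#} then 1 else 0) * F b)"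
        by (rule sum.mono_neutral_right) (auto split: if_splits)
      then show "(\<Sum>(a, b) | a + b = m. (if a = {#} then 1 else 0) * F b) = F m"
        by simp
    qed
  qed
  show "(F + G) * H = F * H + G * H"
    by transfer (simp add: algebra_simps sum.distrib case_prod_unfold)
  show "(0 :: 'a mvps) \<noteq> 1"
    by transfer (auto simp: fun_eq_iff)
qed (transfer; simp add: algebra_simps)+

end

lift_definition mvps_scale :: "'a :: comm_ring_1 \<Rightarrow> 'a mvps \<Rightarrow> 'a mvps"
  is "\<lambda>c F m. c * F m" .

text \<open>
  The formal sum of the monomials \<open>f a\<close> for \<open>a \<in> A\<close>, where \<open>A\<close> may be infinite: the coefficient of
  a monomial is the number of times it occurs.  This is meaningful only if every monomial occurs
  finitely often, as is the case in the two uses below.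
\<close>

lift_definition monomial_sum :: "('b \<Rightarrow> nat multiset) \<Rightarrow> 'b set \<Rightarrow> 'a :: comm_ring_1 mvps"
  is "\<lambda>f A m. of_nat (card {a \<in> A. f a = m})" .


section \<open>Elementary symmetric functions\<close>

text \<open>\<open>e\<^sub>k\<close> is the sum of \<open>\<Prod>i\<in>S. x\<^sub>i\<close> over all \<open>k\<close>-element sets \<open>S\<close> of variable indices.\<close>

definition elem_sym :: "nat \<Rightarrow> rat mvps" where
  "elem_sym k = monomial_sum mset_set {S. finite S \<and> card S = k}"

text \<open>Integer partitions are represented as multisets of positive parts.\<close>

definition is_partition :: "nat multiset \<Rightarrow> bool" where
  "is_partition \<mu> \<longleftrightarrow> 0 \<notin># \<mu>"

definition elem_sym_part :: "nat multiset \<Rightarrow> rat mvps" where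
  "elem_sym_part \<mu> = (\<Prod>k\<in>#\<mu>. elem_sym k)"

definition is_e_expansion :: "(nat multiset \<Rightarrow> rat) \<Rightarrow> rat mvps \<Rightarrow> bool" where
  "is_e_expansion c F \<longleftrightarrow>
     finite {\<mu>. c \<mu> \<noteq> 0} \<and> (\<forall>\<mu>. c \<mu> \<noteq> 0 \<longrightarrow> is_partition \<mu>) \<and>
     F = (\<Sum>\<mu> | c \<mu> \<noteq> 0. mvps_scale (c \<mu>) (elem_sym_part \<mu>))"

text \<open>
  \<open>[e\<^sub>\<mu>] F\<close>.  By the fundamental theorem of symmetric functions the expansion exists and is unique
  for every symmetric function \<open>F\<close> of bounded degree; for other series the value is unspecified.
\<close>

definition e_coeff :: "nat multiset \<Rightarrow> rat mvps \<Rightarrow> rat" where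
  "e_coeff \<mu> F = (THE c. is_e_expansion c F) \<mu>"

definition e_positive :: "rat mvps \<Rightarrow> bool" where
  "e_positive F \<longleftrightarrow> (\<forall>\<mu>. is_partition \<mu> \<longrightarrow> e_coeff \<mu> F \<ge> 0)"


section \<open>Graphs\<close>

text \<open>
  Finite simple graphs are the objects satisfying \<^locale>\<open>pair_graph\<close>: finite, loop-free digraphs
  without parallel arcs whose arc relation is symmetric, each edge being a pair of opposite arcs.
\<close>

definition independent_set :: "'v pair_pre_digraph \<Rightarrow> 'v set \<Rightarrow> bool" where
  "independent_set G S \<longleftrightarrow> S \<subseteq> pverts G \<and> (\<forall>u\<in>S. \<forall>v\<in>S. (u, v) \<notin> parcs G)"

definition independence_number :: "'v pair_pre_digraph \<Rightarrow> nat" where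
  "independence_number G = Max {card S | S. independent_set G S}"

text \<open>
  Colorings are restricted to \<open>pverts G\<close> by extensionality, so that each is counted once.  The
  colors are the variable indices.
\<close>

definition proper_colorings :: "'v pair_pre_digraph \<Rightarrow> ('v \<Rightarrow> nat) set" where
  "proper_colorings G =
     {\<kappa> \<in> pverts G \<rightarrow>\<^sub>E UNIV. \<forall>(u, v)\<in>parcs G. \<kappa> u \<noteq> \<kappa> v}"

definition chromatic_sym :: "'v pair_pre_digraph \<Rightarrow> rat mvps" where
  "chromatic_sym G =
     monomial_sum (\<lambda>\<kappa>. image_mset \<kappa> (mset_set (pverts G))) (proper_colorings G)"

text \<open>
  The following two notions are meant for connected graphs \<open>G\<close> and \<open>H\<close> with the same number \<open>n\<close> of
  vertices, for which the coefficients of \<open>e\<^bsub>(n)\<^esub>\<close> are positive.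
\<close>

definition X_e :: "'v pair_pre_digraph \<Rightarrow> 'w pair_pre_digraph \<Rightarrow> rat mvps" where
  "X_e G H =
     chromatic_sym G -
     mvps_scale (e_coeff {#card (pverts G)#} (chromatic_sym G) /
                 e_coeff {#card (pverts H)#} (chromatic_sym H))
       (chromatic_sym H)"

definition e_ge :: "'v pair_pre_digraph \<Rightarrow> 'w pair_pre_digraph \<Rightarrow> bool" (infix \<open>\<ge>\<^sub>e\<close> 50) where
  "G \<ge>\<^sub>e H \<longleftrightarrow> e_positive (X_e G H)"

end

theory Submission
  imports
    Defs
    "HOL-Library.Multiset_Order"
    "HOL-Combinatorics.Transposition"
    "HOL-Computational_Algebra.Polynomial"
begin

text \<open>
  Write \<open>X\<^sub>e(G,H) = X\<^sub>G - r X\<^sub>H\<close>.  The \<open>e\<^sub>\<mu>\<close> have nonnegative coefficients in the monomials, so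
  \<open>e\<close>-positivity makes every monomial coefficient of \<open>X\<^sub>e(G,H)\<close> nonnegative.  If \<open>k = \<alpha>(H) > \<alpha>(G)\<close>,
  color a maximum independent set of \<open>H\<close> with one color and the other vertices with distinct
  further colors: the resulting monomial, of exponent \<open>k\<close> in one variable, occurs in \<open>X\<^sub>H\<close> but not in
  \<open>X\<^sub>G\<close>, which is a contradiction as soon as \<open>r > 0\<close>.

  For connected \<open>G\<close> the coefficient of \<open>e\<^bsub>(n)\<^esub>\<close> in \<open>X\<^sub>G\<close> is positive because it is, up to the factor
  \<open>(-1)\<^bsup>n-1\<^esup> n\<close>, the linear coefficient of the chromatic polynomial, whose sign is found by
  deletion and contraction.
\<close>

section \<open>Coefficients\<close>

lemma mvps_coeff_zero [simp]: "mvps_coeff 0 m = 0"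
  by transfer simp

lemma mvps_coeff_one: "mvps_coeff 1 m = (if m = {#} then 1 else 0)"
  by transfer simp

lemma mvps_coeff_plus [simp]: "mvps_coeff (F + G) m = mvps_coeff F m + mvps_coeff G m"
  by transfer simp

lemma mvps_coeff_minus [simp]: "mvps_coeff (F - G) m = mvps_coeff F m - mvps_coeff G m"
  by transfer simp

lemma mvps_coeff_scale [simp]: "mvps_coeff (mvps_scale a F) m = a * mvps_coeff F m"
  by transfer simp

lemma mvps_coeff_sum [simp]: "mvps_coeff (\<Sum>x\<in>A. f x) m = (\<Sum>x\<in>A. mvps_coeff (f x) m)"
  by (induction A rule: infinite_finite_induct) auto

lemma mvps_coeff_times:
  "mvps_coeff (F * G) m = (\<Sum>(a, b) | a + b = m. mvps_coeff F a * mvps_coeff G b)"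
  by transfer simp

lemma mvps_coeff_monomial_sum:
  "mvps_coeff (monomial_sum f A) m = of_nat (card {a \<in> A. f a = m})"
  by transfer simp

text \<open>\<open>mset_set (set_mset m) = m\<close> expresses that \<open>m\<close> is squarefree;
  such a monomial arises from exactly one index set, its support.\<close>

lemma mvps_coeff_elem_sym:
  "mvps_coeff (elem_sym k) m = (if mset_set (set_mset m) = m \<and> size m = k then 1 else 0)"
proof -
  have "(finite S \<and> card S = k) \<and> mset_set S = m \<longleftrightarrow>
        (mset_set (set_mset m) = m \<and> size m = k) \<and> S = set_mset m" for S
  proof
    assume "(mset_set (set_mset m) = m \<and> size m = k) \<and> S = set_mset m"
    then show "(finite S \<and> card S = k) \<and> mset_set S = m"
      by (metis finite_set_mset size_mset_set)
  qed auto
  then have "{S \<in> {S. finite S \<and> card S = k}. mset_set S = m} =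
        (if mset_set (set_mset m) = m \<and> size m = k then {set_mset m} else {})"
    by auto
  then show ?thesis
    by (simp add: elem_sym_def mvps_coeff_monomial_sum)
qed

lemma elem_sym_part_empty [simp]: "elem_sym_part {#} = 1"
  and elem_sym_part_add_mset [simp]: "elem_sym_part (add_mset k \<mu>) = elem_sym k * elem_sym_part \<mu>"
  by (simp_all add: elem_sym_part_def)

lemma mvps_coeff_elem_sym_part_nonneg: "mvps_coeff (elem_sym_part \<mu>) m \<ge> 0"
proof (induction \<mu> arbitrary: m)
  case empty
  then show ?case by (simp add: mvps_coeff_one)
next
  case (add k \<mu>)
  then show ?case
    by (auto simp: mvps_coeff_times mvps_coeff_elem_sym intro!: sum_nonneg)
qed


section \<open>Homogeneous and symmetric series\<close>

definition homogeneous :: "nat \<Rightarrow> rat mvps \<Rightarrow> bool" where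
  "homogeneous n F \<longleftrightarrow> (\<forall>m. mvps_coeff F m \<noteq> 0 \<longrightarrow> size m = n)"

text \<open>Arbitrary bijections of the indices are allowed. Since a monomial involves finitely many
  variables, this is the same as invariance under finite permutations.\<close>

definition symmetric_series :: "rat mvps \<Rightarrow> bool" where
  "symmetric_series F \<longleftrightarrow>
     (\<forall>\<pi> m. bij \<pi> \<longrightarrow> mvps_coeff F (image_mset \<pi> m) = mvps_coeff F m)"

lemma homogeneous_times:
  assumes "homogeneous a F" and "homogeneous b G"
  shows "homogeneous (a + b) (F * G)"
  unfolding homogeneous_def
proof (intro allI impI)
  fix m assume "mvps_coeff (F * G) m \<noteq> 0"
  then obtain x y where "x + y = m" "mvps_coeff F x * mvps_coeff G y \<noteq> 0"
    unfolding mvps_coeff_times by (auto elim: sum.not_neutral_contains_not_neutral)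
  with assms show "size m = a + b"
    by (auto simp: homogeneous_def)
qed

lemma homogeneous_elem_sym_part: "homogeneous (\<Sum>\<^sub># \<mu>) (elem_sym_part \<mu>)"
proof (induction \<mu>)
  case empty
  then show ?case by (simp add: homogeneous_def mvps_coeff_one)
next
  case (add k \<mu>)
  moreover have "homogeneous k (elem_sym k)"
    by (simp add: homogeneous_def mvps_coeff_elem_sym)
  ultimately show ?case by (simp add: homogeneous_times)
qed

lemma symmetric_series_times:
  assumes "symmetric_series F" and "symmetric_series G"
  shows "symmetric_series (F * G)"
  unfolding symmetric_series_def
proof (intro allI impI)
  fix \<pi> :: "nat \<Rightarrow> nat" and m
  assume "bij \<pi>"
  then have inv: "image_mset \<pi> (image_mset (inv \<pi>) x) = x"
      "image_mset (inv \<pi>) (image_mset \<pi> x) = x" for x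
    by (simp_all add: multiset.map_comp comp_def bij_is_inj bij_is_surj surj_f_inv_f)
  show "mvps_coeff (F * G) (image_mset \<pi> m) = mvps_coeff (F * G) m"
    unfolding mvps_coeff_times
    by (rule sum.reindex_bij_witness
          [where i = "map_prod (image_mset \<pi>) (image_mset \<pi>)"
             and j = "map_prod (image_mset (inv \<pi>)) (image_mset (inv \<pi>))"])
       (use assms \<open>bij \<pi>\<close> in \<open>auto simp: inv symmetric_series_def bij_imp_bij_inv simp flip: image_mset_union\<close>)
qed

text \<open>An injective renaming of the variables preserves both degree and squarefreeness.\<close>

lemma symmetric_series_elem_sym: "symmetric_series (elem_sym k)"
  unfolding symmetric_series_def
proof (intro allI impI)
  fix \<pi> :: "nat \<Rightarrow> nat" and m
  assume "bij \<pi>"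
  then have "inj \<pi>" by (rule bij_is_inj)
  have "mset_set (set_mset (image_mset \<pi> m)) = image_mset \<pi> m \<longleftrightarrow> mset_set (set_mset m) = m"
  proof -
    have "mset_set (set_mset (image_mset \<pi> m)) = image_mset \<pi> (mset_set (set_mset m))"
      using \<open>inj \<pi>\<close> by (simp add: image_mset_mset_set inj_on_subset)
    then show ?thesis
      by (metis \<open>inj \<pi>\<close> multiset.inj_map injD)
  qed
  then show "mvps_coeff (elem_sym k) (image_mset \<pi> m) = mvps_coeff (elem_sym k) m"
    by (simp add: mvps_coeff_elem_sym)
qed

lemma symmetric_series_elem_sym_part: "symmetric_series (elem_sym_part \<mu>)"
proof (induction \<mu>)
  case empty
  then show ?case by (simp add: symmetric_series_def mvps_coeff_one)
next
  case (add k \<mu>)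
  then show ?case by (simp add: symmetric_series_times symmetric_series_elem_sym)
qed


section \<open>Minimal monomials\<close>

text \<open>
  Monomials carry the well-founded multiset extension of the order on variable indices, which is
  compatible with multiplication of monomials.
\<close>

definition min_monom :: "nat multiset \<Rightarrow> nat multiset" where
  "min_monom \<mu> = (\<Sum>k\<in>#\<mu>. mset_set {..<k})"

lemma min_monom_empty [simp]: "min_monom {#} = {#}"
  and min_monom_add_mset [simp]: "min_monom (add_mset k \<mu>) = mset_set {..<k} + min_monom \<mu>"
  by (simp_all add: min_monom_def)

lemma size_min_monom [simp]: "size (min_monom \<mu>) = \<Sum>\<^sub># \<mu>"
  by (induction \<mu>) auto

text \<open>The exponents of \<open>min_monom \<mu>\<close> are thus the parts of the conjugate
  partition.\<close>

lemma count_min_monom: "count (min_monom \<mu>) i = size (filter_mset (\<lambda>k. i < k) \<mu>)"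
  by (induction \<mu>) (auto simp: count_mset_set')

text \<open>The number of parts equal to i + 1 is the difference of the exponents at i and i + 1.
  Zero parts leave no trace in the monomial, so both multisets must be partitions.\<close>

lemma min_monom_inject:
  assumes "is_partition \<mu>" and "is_partition \<nu>" and "min_monom \<mu> = min_monom \<nu>"
  shows "\<mu> = \<nu>"
proof (rule multiset_eqI)
  have count_Suc: "count \<xi> (Suc i) + count (min_monom \<xi>) (Suc i) = count (min_monom \<xi>) i"
    for \<xi> :: "nat multiset" and i
    by (induction \<xi>) (auto simp: count_mset_set')
  fix k show "count \<mu> k = count \<nu> k"
  proof (cases k)
    case 0
    with assms show ?thesis by (simp add: is_partition_def flip: count_eq_zero_iff)
  next
    case (Suc i)
    with assms count_Suc[of \<mu> i] count_Suc[of \<nu> i] show ?thesis by simp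
  qed
qed

text \<open>Normalizing the coefficient to 1 makes the property multiplicative and the expansion in
  the \<open>elem_sym_part \<mu>\<close> unitriangular.\<close>

definition has_min_monom :: "rat mvps \<Rightarrow> nat multiset \<Rightarrow> bool" where
  "has_min_monom F M \<longleftrightarrow> mvps_coeff F M = 1 \<and> (\<forall>m. mvps_coeff F m \<noteq> 0 \<longrightarrow> M \<le> m)"

lemma has_min_monom_times:
  assumes "has_min_monom F M" and "has_min_monom G N"
  shows "has_min_monom (F * G) (M + N)"
  unfolding has_min_monom_def
proof (intro conjI allI impI)
  \<comment> \<open>Compatibility of the order with addition: two monomials of the supports multiply
    to \<open>M + N\<close> only if both are minimal, so no other splitting contributes.\<close>
  have only: "a = M \<and> b = N"
    if "a + b = M + N" "mvps_coeff F a \<noteq> 0" "mvps_coeff G b \<noteq> 0" for a b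
  proof (rule ccontr)
    assume "\<not> (a = M \<and> b = N)"
    with that(1) have "M \<noteq> a" by auto
    with that(2,3) assms have "M + N < a + b"
      by (intro add_less_le_mono) (simp_all add: has_min_monom_def less_le)
    with that(1) show False by simp
  qed
  have "(\<Sum>(a, b) | a + b = M + N. mvps_coeff F a * mvps_coeff G b) =
        (\<Sum>(a, b)\<in>{(M, N)}. mvps_coeff F a * mvps_coeff G b)"
    by (intro sum.mono_neutral_right) (auto dest: only)
  with assms show "mvps_coeff (F * G) (M + N) = 1"
    by (simp add: mvps_coeff_times has_min_monom_def)
next
  fix m assume "mvps_coeff (F * G) m \<noteq> 0"
  then obtain a b where "a + b = m" "mvps_coeff F a * mvps_coeff G b \<noteq> 0"
    unfolding mvps_coeff_times by (auto elim: sum.not_neutral_contains_not_neutral)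
  with assms show "M + N \<le> m"
    by (auto simp: has_min_monom_def intro: add_mono)
qed

text \<open>The multiset order is decided at the largest index where the multisets differ. A
  k-element set missing some y < k must contain an element that is at least k.\<close>

lemma mset_set_lessThan_le:
  fixes S :: "nat set"
  assumes "finite S" and "card S = k"
  shows "mset_set {..<k} \<le> mset_set S"
  unfolding less_eq_multiset\<^sub>H\<^sub>O
proof (intro allI impI)
  fix y assume "count (mset_set S) y < count (mset_set {..<k}) y"
  then have y: "y < k" "y \<notin> S"
    using assms by (auto simp: count_mset_set' split: if_splits)
  have "\<exists>x\<in>S. k \<le> x"
  proof (rule ccontr)
    assume "\<not> (\<exists>x\<in>S. k \<le> x)"
    then have "S \<subset> {..<k}" using y by force
    then have "card S < card {..<k}" by (intro psubset_card_mono) auto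
    with assms show False by simp
  qed
  then obtain x where "x \<in> S" "k \<le> x" by blast
  with y assms show "\<exists>x>y. count (mset_set {..<k}) x < count (mset_set S) x"
    by (intro exI[of _ x]) (auto simp: count_mset_set')
qed

text \<open>By multiplicativity it suffices to treat one factor \<open>elem_sym k\<close>, with
  minimal monomial the product of the first k variables.\<close>

lemma has_min_monom_elem_sym_part: "has_min_monom (elem_sym_part \<mu>) (min_monom \<mu>)"
proof (induction \<mu>)
  case empty
  then show ?case by (simp add: has_min_monom_def mvps_coeff_one)
next
  case (add k \<mu>)
  have "has_min_monom (elem_sym k) (mset_set {..<k})"
    unfolding has_min_monom_def
  proof (intro conjI allI impI)
    show "mvps_coeff (elem_sym k) (mset_set {..<k}) = 1"
      by (simp add: mvps_coeff_elem_sym)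
    fix m assume "mvps_coeff (elem_sym k) m \<noteq> 0"
    then have "mset_set (set_mset m) = m" "size m = k"
      by (auto simp: mvps_coeff_elem_sym split: if_splits)
    then show "mset_set {..<k} \<le> m"
      by (metis finite_set_mset mset_set_lessThan_le size_mset_set)
  qed
  with add show ?case by (simp add: has_min_monom_times)
qed

text \<open>\<open>m\<close> is the minimal monomial of the conjugate of the partition with parts \<open>count m i\<close>.\<close>

lemma ex_partition_min_monom:
  assumes decr: "\<And>i. count m (Suc i) \<le> count m i"
  shows "\<exists>\<mu>. is_partition \<mu> \<and> min_monom \<mu> = m"
proof -
  have antimono: "count m j \<le> count m i" if "i \<le> j" for i j
    using lift_Suc_antimono_le[of "count m", OF decr that] .
  \<comment> \<open>Since the exponents decrease, \<open>K j\<close> is an initial segment of the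
    indices for j \<ge> 1; its size is the j-th part of the conjugate partition. \<open>K 0\<close>
    is the infinite set of all indices.\<close>
  define K where "K j = {i. j \<le> count m i}" for j
  define \<mu> where "\<mu> = image_mset (\<lambda>j. card (K j)) (mset_set {1..count m 0})"
  have fin: "finite (K j)" if "j \<ge> 1" for j
    by (rule finite_subset[of _ "set_mset m"])
       (use that in \<open>auto simp: K_def count_greater_zero_iff[symmetric] simp del: count_greater_zero_iff\<close>)
  have less_card: "i < card (K j) \<longleftrightarrow> j \<le> count m i" if "j \<ge> 1" for i j
  proof
    assume "j \<le> count m i"
    then have "{..i} \<subseteq> K j" using antimono by (force simp: K_def)
    from card_mono[OF fin[OF that] this] show "i < card (K j)" by simp
  next
    assume less: "i < card (K j)"
    show "j \<le> count m i"
    proof (rule ccontr)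
      assume "\<not> j \<le> count m i"
      then have "K j \<subseteq> {..<i}"
        unfolding K_def using antimono by (force simp: not_le[symmetric])
      from card_mono[OF _ this] less show False by simp
    qed
  qed
  have "is_partition \<mu>"
    unfolding is_partition_def
  proof
    assume "0 \<in># \<mu>"
    then obtain j where "j \<in> {1..count m 0}" "card (K j) = 0"
      by (auto simp: \<mu>_def)
    with less_card[of j 0] show False by simp
  qed
  moreover have "min_monom \<mu> = m"
  proof (rule multiset_eqI)
    fix i
    have "count (min_monom \<mu>) i = card {j \<in> {1..count m 0}. i < card (K j)}"
      by (simp add: count_min_monom \<mu>_def filter_mset_image_mset filter_mset_mset_set comp_def)
    also have "{j \<in> {1..count m 0}. i < card (K j)} = {1..count m i}"
      using less_card antimono[of 0 i] by fastforce
    finally show "count (min_monom \<mu>) i = count m i" by simp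
  qed
  ultimately show ?thesis by blast
qed

text \<open>If an exponent increased from i to i + 1, exchanging the two variables would move the
  larger exponent to the smaller index and give, by symmetry, a smaller monomial of the
  series.\<close>

lemma symmetric_series_min_monom:
  assumes "symmetric_series F" and "mvps_coeff F m \<noteq> 0"
    and min: "\<And>m'. mvps_coeff F m' \<noteq> 0 \<Longrightarrow> m \<le> m'"
  shows "\<exists>\<mu>. is_partition \<mu> \<and> min_monom \<mu> = m"
proof (rule ex_partition_min_monom, rule ccontr)
  fix i assume "\<not> count m (Suc i) \<le> count m i"
  then have less: "count m i < count m (Suc i)" by simp
  define m' where "m' = image_mset (transpose i (Suc i)) m"
  have "transpose i (Suc i) a = x \<longleftrightarrow> a = transpose i (Suc i) x" for a x
    by (metis transpose_involutory)
  then have count: "count m' x = count m (transpose i (Suc i) x)" for x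
    unfolding m'_def by (induction m) auto
  have "m' \<noteq> m"
    using less count[of i] by auto
  moreover have "\<exists>x>y. count m' x < count m x" if "count m y < count m' y" for y
    using that less by (intro exI[of _ "Suc i"]) (auto simp: count transpose_def split: if_splits)
  ultimately have "m' < m"
    unfolding less_multiset\<^sub>H\<^sub>O by blast
  moreover have "mvps_coeff F m' \<noteq> 0"
    using assms by (simp add: m'_def symmetric_series_def)
  ultimately show False
    using min[of m'] by simp
qed


section \<open>Expansions in elementary symmetric functions\<close>

text \<open>Summing over any finite superset of the support lets several expansions share one index
  set.\<close>

lemma is_e_expansionD:
  assumes "is_e_expansion c F" and "finite A" and "{\<mu>. c \<mu> \<noteq> 0} \<subseteq> A"
  shows "mvps_coeff F m = (\<Sum>\<mu>\<in>A. c \<mu> * mvps_coeff (elem_sym_part \<mu>) m)"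
proof -
  have "mvps_coeff F m = (\<Sum>\<mu> | c \<mu> \<noteq> 0. c \<mu> * mvps_coeff (elem_sym_part \<mu>) m)"
    using assms(1) by (simp add: is_e_expansion_def)
  also have "\<dots> = (\<Sum>\<mu>\<in>A. c \<mu> * mvps_coeff (elem_sym_part \<mu>) m)"
    using assms(2,3) by (intro sum.mono_neutral_left) auto
  finally show ?thesis .
qed

lemma is_e_expansionI:
  assumes "finite A" and "\<And>\<mu>. c \<mu> \<noteq> 0 \<Longrightarrow> \<mu> \<in> A \<and> is_partition \<mu>"
    and "\<And>m. mvps_coeff F m = (\<Sum>\<mu>\<in>A. c \<mu> * mvps_coeff (elem_sym_part \<mu>) m)"
  shows "is_e_expansion c F"
  unfolding is_e_expansion_def
proof (intro conjI allI impI mvps_eqI)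
  have sub: "{\<mu>. c \<mu> \<noteq> 0} \<subseteq> A" using assms(2) by auto
  then show "finite {\<mu>. c \<mu> \<noteq> 0}" using assms(1) finite_subset by blast
  fix m
  have "mvps_coeff F m = (\<Sum>\<mu> | c \<mu> \<noteq> 0. c \<mu> * mvps_coeff (elem_sym_part \<mu>) m)"
    unfolding assms(3) using assms(1) sub by (intro sum.mono_neutral_right) auto
  then show "mvps_coeff F m =
      mvps_coeff (\<Sum>\<mu> | c \<mu> \<noteq> 0. mvps_scale (c \<mu>) (elem_sym_part \<mu>)) m"
    by simp
qed (use assms(2) in auto)

lemma is_e_expansion_plus_scale:
  assumes c: "is_e_expansion c F" and d: "is_e_expansion d G"
  shows "is_e_expansion (\<lambda>\<mu>. c \<mu> + a * d \<mu>) (F + mvps_scale a G)"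
proof (rule is_e_expansionI)
  let ?A = "{\<mu>. c \<mu> \<noteq> 0} \<union> {\<mu>. d \<mu> \<noteq> 0}"
  show fin: "finite ?A" using c d by (simp add: is_e_expansion_def)
  show "\<mu> \<in> ?A \<and> is_partition \<mu>" if "c \<mu> + a * d \<mu> \<noteq> 0" for \<mu>
    using that c d unfolding is_e_expansion_def by force
  show "mvps_coeff (F + mvps_scale a G) m =
      (\<Sum>\<mu>\<in>?A. (c \<mu> + a * d \<mu>) * mvps_coeff (elem_sym_part \<mu>) m)" for m
    by (simp add: is_e_expansionD[OF c fin] is_e_expansionD[OF d fin] algebra_simps
        sum.distrib sum_distrib_left)
qed

lemma is_e_expansion_elem_sym_part:
  assumes "is_partition \<nu>"
  shows "is_e_expansion (\<lambda>\<mu>. if \<mu> = \<nu> then 1 else 0) (elem_sym_part \<nu>)"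
  by (rule is_e_expansionI[of "{\<nu>}"]) (use assms in \<open>auto split: if_splits\<close>)

text \<open>Linear independence: among the \<mu> with nonzero coefficient, take one with the
  smallest \<open>min_monom \<mu>\<close>. No other term contains this monomial, so it cannot
  cancel.\<close>

lemma is_e_expansion_zero_unique:
  assumes c: "is_e_expansion c 0"
  shows "c \<mu> = 0"
proof (rule ccontr)
  let ?A = "{\<mu>. c \<mu> \<noteq> 0}"
  assume "c \<mu> \<noteq> 0"
  define M where "M = (LEAST M. \<exists>\<mu>. c \<mu> \<noteq> 0 \<and> M = min_monom \<mu>)"
  have "\<exists>\<mu>. c \<mu> \<noteq> 0 \<and> M = min_monom \<mu>"
    unfolding M_def by (rule LeastI[of _ "min_monom \<mu>"]) (use \<open>c \<mu> \<noteq> 0\<close> in blast)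
  then obtain \<nu> where \<nu>: "c \<nu> \<noteq> 0" "M = min_monom \<nu>" by blast
  have min: "min_monom \<nu> \<le> min_monom \<xi>" if "c \<xi> \<noteq> 0" for \<xi>
    unfolding \<nu>(2)[symmetric] M_def by (rule Least_le) (use that in blast)
  have fin: "finite ?A" and part: "\<And>\<xi>. c \<xi> \<noteq> 0 \<Longrightarrow> is_partition \<xi>"
    using c by (auto simp: is_e_expansion_def)
  have "mvps_coeff (elem_sym_part \<xi>) (min_monom \<nu>) = 0" if "c \<xi> \<noteq> 0" "\<xi> \<noteq> \<nu>" for \<xi>
  proof (rule ccontr)
    assume "mvps_coeff (elem_sym_part \<xi>) (min_monom \<nu>) \<noteq> 0"
    then have "min_monom \<xi> \<le> min_monom \<nu>"
      using has_min_monom_elem_sym_part[of \<xi>] by (simp add: has_min_monom_def)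
    with min[OF that(1)] min_monom_inject[of \<xi> \<nu>] part \<nu> that show False by simp
  qed
  then have "(\<Sum>\<xi>\<in>?A. c \<xi> * mvps_coeff (elem_sym_part \<xi>) (min_monom \<nu>)) =
             (\<Sum>\<xi>\<in>{\<nu>}. c \<xi> * mvps_coeff (elem_sym_part \<xi>) (min_monom \<nu>))"
    using \<nu> fin by (intro sum.mono_neutral_right) auto
  also have "\<dots> = c \<nu>"
    using has_min_monom_elem_sym_part[of \<nu>] by (simp add: has_min_monom_def)
  finally show False
    using is_e_expansionD[OF c fin order_refl, of "min_monom \<nu>"] \<nu> by simp
qed

lemma is_e_expansion_unique:
  assumes c: "is_e_expansion c F" and d: "is_e_expansion d F"
  shows "c = d"
proof
  fix \<mu>
  have "F + mvps_scale (- 1) F = 0"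
    by (rule mvps_eqI) simp
  then have "is_e_expansion (\<lambda>\<mu>. c \<mu> + (- 1) * d \<mu>) 0"
    using is_e_expansion_plus_scale[OF c d, of "- 1"] by simp
  from is_e_expansion_zero_unique[OF this, of \<mu>] show "c \<mu> = d \<mu>" by simp
qed

text \<open>Uniqueness resolves the definite description in \<open>e_coeff\<close>, so coefficients
  can be read off from any expansion.\<close>

lemma e_coeff_eq:
  assumes "is_e_expansion c F"
  shows "e_coeff \<mu> F = c \<mu>"
proof -
  have "(THE d. is_e_expansion d F) = c"
    using assms is_e_expansion_unique by (intro the_equality) auto
  then show ?thesis by (simp add: e_coeff_def)
qed

text \<open>Positive parts with sum n are at most n in number, and each is at most n.\<close>

lemma finite_partitions: "finite {\<mu>. is_partition \<mu> \<and> \<Sum>\<^sub># \<mu> = n}"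
proof (rule finite_subset)
  show "finite (\<Union>k\<in>{..n}. multisets_of_size {..n} k)"
    by (intro finite_UN_I finite_multisets_of_size) simp_all
  have "size \<mu> \<le> \<Sum>\<^sub># \<mu>" if "is_partition \<mu>" for \<mu>
    using that by (induction \<mu>) (auto simp: is_partition_def)
  moreover have "k \<le> \<Sum>\<^sub># \<mu>" if "k \<in># \<mu>" for k and \<mu> :: "nat multiset"
    using that by (auto dest!: multi_member_split)
  ultimately show "{\<mu>. is_partition \<mu> \<and> \<Sum>\<^sub># \<mu> = n} \<subseteq>
      (\<Union>k\<in>{..n}. multisets_of_size {..n} k)"
    unfolding multisets_of_size_def by blast
qed

text \<open>The minimal monomial of F is \<open>min_monom \<nu>\<close> for a partition \<nu>;
  subtracting the matching multiple of \<open>elem_sym_part \<nu>\<close> removes it, and the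
  process is repeated.\<close>

lemma ex_e_expansion:
  assumes "symmetric_series F" and "homogeneous n F"
  shows "\<exists>c. is_e_expansion c F \<and> (\<forall>\<mu>. c \<mu> \<noteq> 0 \<longrightarrow> \<Sum>\<^sub># \<mu> = n)"
proof -
  \<comment> \<open>Minimal monomials increase during the process, so well-foundedness of the order
    does not give termination. Instead, the finitely many partitions of n whose minimal monomial can
    still be reached are counted.\<close>
  define D where "D F = {\<mu>. (is_partition \<mu> \<and> \<Sum>\<^sub># \<mu> = n) \<and>
    (\<exists>m. mvps_coeff F m \<noteq> 0 \<and> m \<le> min_monom \<mu>)}" for F :: "rat mvps"
  have finite_D: "finite (D F)" for F
    unfolding D_def by (rule finite_subset[OF _ finite_partitions[of n]]) blast
  show ?thesis
    using assms
  proof (induction "card (D F)" arbitrary: F rule: less_induct)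
    case less
    show ?case
    proof (cases "F = 0")
      case True
      have "is_e_expansion (\<lambda>\<mu>. 0) 0"
        by (rule is_e_expansionI[of "{}"]) auto
      with True show ?thesis by (intro exI[of _ "\<lambda>\<mu>. 0"]) simp
    next
      case False
      then obtain m' where m': "mvps_coeff F m' \<noteq> 0"
        by (metis mvps_eqI mvps_coeff_zero)
      define m where "m = (LEAST m. mvps_coeff F m \<noteq> 0)"
      have m: "mvps_coeff F m \<noteq> 0"
        unfolding m_def using m' by (rule LeastI)
      have min: "m \<le> m'" if "mvps_coeff F m' \<noteq> 0" for m'
        unfolding m_def using that by (rule Least_le)
      obtain \<nu> where \<nu>: "is_partition \<nu>" "min_monom \<nu> = m"
        using symmetric_series_min_monom[OF less.prems(1) m min] by auto
      have size: "\<Sum>\<^sub># \<nu> = n"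
        using less.prems(2) m \<nu> by (metis homogeneous_def size_min_monom)
      define F' where "F' = F - mvps_scale (mvps_coeff F m) (elem_sym_part \<nu>)"
      have supp: "mvps_coeff F m' \<noteq> 0 \<or> mvps_coeff (elem_sym_part \<nu>) m' \<noteq> 0"
        if "mvps_coeff F' m' \<noteq> 0" for m'
        using that by (auto simp: F'_def)
      have F': "symmetric_series F'" "homogeneous n F'"
        using less.prems symmetric_series_elem_sym_part[of \<nu>]
          homogeneous_elem_sym_part[of \<nu>] size supp
        by (simp_all add: F'_def symmetric_series_def homogeneous_def) blast
      have greater: "m < m'" if "mvps_coeff F' m' \<noteq> 0" for m'
      proof -
        have "m \<le> m'"
          using supp[OF that] min has_min_monom_elem_sym_part[of \<nu>] \<nu> by (auto simp: has_min_monom_def)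
        moreover have "mvps_coeff F' m = 0"
          using has_min_monom_elem_sym_part[of \<nu>] \<nu> by (simp add: F'_def has_min_monom_def)
        ultimately show ?thesis using that by (metis le_neq_trans)
      qed
      \<comment> \<open>All monomials of \<open>F'\<close> lie strictly above
        \<open>m = min_monom \<nu>\<close>, so \<nu> drops out, and whatever lies above one of them
        lies above \<open>m\<close>.\<close>
      have "\<nu> \<in> D F - D F'"
        using \<nu> size m greater by (force simp: D_def)
      moreover have "D F' \<subseteq> D F"
        using m greater by (force simp: D_def)
      ultimately have "card (D F') < card (D F)"
        using finite_D by (intro psubset_card_mono) auto
      from less.hyps[OF this F'] obtain c where
        c: "is_e_expansion c F'" "\<forall>\<mu>. c \<mu> \<noteq> 0 \<longrightarrow> \<Sum>\<^sub># \<mu> = n" by auto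
      let ?c = "\<lambda>\<mu>. c \<mu> + mvps_coeff F m * (if \<mu> = \<nu> then 1 else 0)"
      have "F' + mvps_scale (mvps_coeff F m) (elem_sym_part \<nu>) = F"
        by (rule mvps_eqI) (simp add: F'_def)
      then have "is_e_expansion ?c F"
        using is_e_expansion_plus_scale[OF c(1) is_e_expansion_elem_sym_part[OF \<nu>(1)]] by metis
      moreover have "\<forall>\<mu>. ?c \<mu> \<noteq> 0 \<longrightarrow> \<Sum>\<^sub># \<mu> = n"
        using c(2) size by auto
      ultimately show ?thesis by (intro exI[of _ ?c]) simp
    qed
  qed
qed


section \<open>The linear coefficient of the chromatic polynomial\<close>

text \<open>Stated for a bare vertex set and relation so that deletion and contraction act directly
  on them; the cardinality is the chromatic polynomial at q.\<close>

definition colorings_below :: "'v set \<Rightarrow> 'v rel \<Rightarrow> nat \<Rightarrow> ('v \<Rightarrow> nat) set" where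
  "colorings_below V E q = {\<kappa> \<in> V \<rightarrow>\<^sub>E {..<q}. \<forall>(u, v)\<in>E. \<kappa> u \<noteq> \<kappa> v}"

lemma finite_colorings_below: "finite V \<Longrightarrow> finite (colorings_below V E q)"
  unfolding colorings_below_def by (rule rev_finite_subset[OF finite_PiE[of V "\<lambda>_. {..<q}"]]) auto

definition delete_edge :: "'v rel \<Rightarrow> 'v \<Rightarrow> 'v \<Rightarrow> 'v rel" where
  "delete_edge E u v = E - {(u, v), (v, u)}"

definition merge :: "'v \<Rightarrow> 'v \<Rightarrow> 'v \<Rightarrow> 'v" where
  "merge u v = id(v := u)"

text \<open>The vertex v is absorbed into u. Deleting the edge first avoids a loop at u; parallel
  edges coincide because a relation is a set.\<close>

definition contract_edge :: "'v rel \<Rightarrow> 'v \<Rightarrow> 'v \<Rightarrow> 'v rel" where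
  "contract_edge E u v = map_prod (merge u v) (merge u v) ` delete_edge E u v"

context
  fixes V :: "'v set" and E :: "'v rel" and u v :: 'v
  assumes E: "E \<subseteq> V \<times> V" "sym E" "irrefl E" and uv: "(u, v) \<in> E"
begin

lemma edge_endpoints: "u \<noteq> v" "u \<in> V" "v \<in> V" "(v, u) \<in> E"
  using E uv by (auto simp: irrefl_def dest: symD)

lemma delete_edge:
  "delete_edge E u v \<subseteq> V \<times> V" "sym (delete_edge E u v)"
  "irrefl (delete_edge E u v)" "delete_edge E u v \<subset> E"
  using E uv by (auto simp: delete_edge_def sym_def irrefl_def)

lemma contract_edge:
  "contract_edge E u v \<subseteq> (V - {v}) \<times> (V - {v})" "sym (contract_edge E u v)"
  "irrefl (contract_edge E u v)"
proof -
  show "contract_edge E u v \<subseteq> (V - {v}) \<times> (V - {v})"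
    using delete_edge(1) edge_endpoints by (auto simp: contract_edge_def merge_def split: if_splits)
  show "sym (contract_edge E u v)"
  proof (rule symI)
    fix a b assume "(a, b) \<in> contract_edge E u v"
    then obtain x y where "(x, y) \<in> delete_edge E u v" "a = merge u v x" "b = merge u v y"
      by (auto simp: contract_edge_def)
    with delete_edge(2) show "(b, a) \<in> contract_edge E u v"
      by (auto simp: contract_edge_def dest: symD intro!: image_eqI[of _ _ "(y, x)"])
  qed
  show "irrefl (contract_edge E u v)"
    using E(3) by (auto simp: contract_edge_def merge_def delete_edge_def irrefl_def split: if_splits)
qed

text \<open>Each step of a walk either survives as an arc or collapses to a point, so contraction
  preserves connectedness.\<close>

lemma contract_edge_rtrancl:
  assumes "(a, b) \<in> E\<^sup>*"
  shows "(merge u v a, merge u v b) \<in> (contract_edge E u v)\<^sup>*"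
  using assms
proof induction
  case base
  then show ?case by simp
next
  case (step y z)
  have "merge u v y = merge u v z \<or> (merge u v y, merge u v z) \<in> contract_edge E u v"
  proof (cases "(y, z) \<in> delete_edge E u v")
    case True
    then show ?thesis by (auto simp: contract_edge_def)
  next
    case False
    with step.hyps(2) show ?thesis by (auto simp: delete_edge_def merge_def)
  qed
  with step.IH show ?case by (metis rtrancl.rtrancl_into_rtrancl)
qed

text \<open>Colorings without the edge are split by whether its endpoints differ, which gives the
  colorings of E, or agree, which gives those of the contraction.\<close>

lemma card_colorings_below_deletion_contraction:
  assumes "finite V"
  shows "card (colorings_below V (delete_edge E u v) q) =
         card (colorings_below V E q) + card (colorings_below (V - {v}) (contract_edge E u v) q)"
proof -
  let ?S = "{\<kappa> \<in> colorings_below V (delete_edge E u v) q. \<kappa> u = \<kappa> v}"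
  have split: "colorings_below V (delete_edge E u v) q = colorings_below V E q \<union> ?S"
  proof (intro equalityI subsetI)
    fix \<kappa> assume "\<kappa> \<in> colorings_below V (delete_edge E u v) q"
    then show "\<kappa> \<in> colorings_below V E q \<union> ?S"
      by (cases "\<kappa> u = \<kappa> v") (auto simp: colorings_below_def delete_edge_def)
  qed (auto simp: colorings_below_def delete_edge_def)
  have disj: "colorings_below V E q \<inter> ?S = {}"
    using uv by (auto simp: colorings_below_def)
  \<comment> \<open>Forgetting the color of v loses nothing when it equals that of u.\<close>
  have "bij_betw (\<lambda>\<kappa>. restrict \<kappa> (V - {v})) ?S (colorings_below (V - {v}) (contract_edge E u v) q)"
  proof (rule bij_betw_byWitness[where f' = "\<lambda>\<kappa>. \<kappa>(v := \<kappa> u)"])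
    show "\<forall>\<kappa>\<in>?S. (restrict \<kappa> (V - {v}))(v := restrict \<kappa> (V - {v}) u) = \<kappa>"
      using edge_endpoints by (auto simp: colorings_below_def fun_eq_iff PiE_def extensional_def)
    show "\<forall>\<kappa>\<in>colorings_below (V - {v}) (contract_edge E u v) q. restrict (\<kappa>(v := \<kappa> u)) (V - {v}) = \<kappa>"
      by (auto simp: colorings_below_def fun_eq_iff PiE_def extensional_def)
    show "(\<lambda>\<kappa>. restrict \<kappa> (V - {v})) ` ?S \<subseteq> colorings_below (V - {v}) (contract_edge E u v) q"
    proof (intro image_subsetI)
      fix \<kappa> assume \<kappa>: "\<kappa> \<in> ?S"
      have "restrict \<kappa> (V - {v}) (merge u v a) = \<kappa> a" if "a \<in> V" for a
        using that \<kappa> edge_endpoints by (auto simp: merge_def)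
      moreover have "\<forall>(a, b)\<in>delete_edge E u v. a \<in> V \<and> b \<in> V"
        using delete_edge by auto
      ultimately show "restrict \<kappa> (V - {v}) \<in> colorings_below (V - {v}) (contract_edge E u v) q"
        using \<kappa> by (fastforce simp: colorings_below_def contract_edge_def)
    qed
    show "(\<lambda>\<kappa>. \<kappa>(v := \<kappa> u)) ` colorings_below (V - {v}) (contract_edge E u v) q \<subseteq> ?S"
    proof (intro image_subsetI)
      fix \<kappa> assume \<kappa>: "\<kappa> \<in> colorings_below (V - {v}) (contract_edge E u v) q"
      have "(\<kappa>(v := \<kappa> u)) a = \<kappa> (merge u v a)" for a
        by (auto simp: merge_def)
      moreover have "\<kappa> (merge u v a) \<noteq> \<kappa> (merge u v b)" if "(a, b) \<in> delete_edge E u v" for a b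
        using \<kappa> that by (force simp: colorings_below_def contract_edge_def)
      moreover have "\<kappa>(v := \<kappa> u) \<in> V \<rightarrow>\<^sub>E {..<q}"
        using \<kappa> edge_endpoints by (auto simp: colorings_below_def PiE_def extensional_def Pi_def)
      ultimately show "\<kappa>(v := \<kappa> u) \<in> ?S"
        using edge_endpoints by (auto simp: colorings_below_def)
    qed
  qed
  then have "card ?S = card (colorings_below (V - {v}) (contract_edge E u v) q)"
    by (rule bij_betw_same_card)
  moreover have "finite (colorings_below V E q)" "finite ?S"
    using finite_colorings_below[OF assms] by auto
  ultimately show ?thesis
    using arg_cong[OF split, of card] disj by (simp add: card_Un_disjoint)
qed

end

text \<open>The weak inequality for all graphs is carried along because deletion may disconnect the
  graph; strictness comes from the contraction, which stays connected.\<close>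

lemma chromatic_polynomial:
  fixes V :: "'v set"
  assumes "finite V" and "V \<noteq> {}" and "E \<subseteq> V \<times> V" and "sym E" and "irrefl E"
  shows "\<exists>p :: rat poly. (\<forall>q. poly p (of_nat q) = of_nat (card (colorings_below V E q))) \<and>
           (- 1) ^ card V * coeff p 1 \<le> 0 \<and>
           ((\<forall>a\<in>V. \<forall>b\<in>V. (a, b) \<in> E\<^sup>*) \<longrightarrow> (- 1) ^ card V * coeff p 1 < 0)"
  using assms
proof (induction "card E" arbitrary: V E rule: less_induct)
  case less
  have finE: "finite E"
    using less.prems by (meson finite_SigmaI finite_subset)
  show ?case
  proof (cases "E = {}")
    case True
    \<comment> \<open>The polynomial is a pure power, with a linear term only for a single vertex,
      the only connected edgeless case.\<close>
    have "card (colorings_below V E q) = q ^ card V" for q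
      using less.prems(1) True by (simp add: colorings_below_def card_PiE)
    moreover have "card V = 1" if "\<forall>a\<in>V. \<forall>b\<in>V. (a, b) \<in> E\<^sup>*"
    proof -
      from that True have "\<forall>a\<in>V. \<forall>b\<in>V. a = b" by simp
      with less.prems(2) obtain a where "V = {a}" by blast
      then show ?thesis by simp
    qed
    ultimately show ?thesis
      by (intro exI[of _ "monom 1 (card V)"]) (auto simp: poly_monom)
  next
    case False
    then obtain u v where uv: "(u, v) \<in> E" by auto
    note E = less.prems(3-5) uv
    let ?D = "delete_edge E u v" and ?C = "contract_edge E u v"
    have V': "V - {v} \<noteq> {}" "card V = Suc (card (V - {v}))"
      using edge_endpoints[OF E] card.remove[OF less.prems(1), of v] by auto
    have lessD: "card ?D < card E"
      using delete_edge(4)[OF E] finE by (rule psubset_card_mono[rotated])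
    moreover have "card ?C \<le> card ?D"
      unfolding contract_edge_def
      by (rule card_image_le) (use delete_edge(4)[OF E] finE finite_subset in auto)
    ultimately have lessC: "card ?C < card E" by simp
    obtain p where p: "\<And>q. poly p (of_nat q) = of_nat (card (colorings_below V ?D q))"
        "(- 1) ^ card V * coeff p 1 \<le> (0 :: rat)"
      using less.hyps[OF lessD less.prems(1,2) delete_edge(1-3)[OF E]] by auto
    obtain r where r: "\<And>q. poly r (of_nat q) = of_nat (card (colorings_below (V - {v}) ?C q))"
        "(- 1) ^ card (V - {v}) * coeff r 1 \<le> (0 :: rat)"
        "(\<forall>a\<in>V - {v}. \<forall>b\<in>V - {v}. (a, b) \<in> ?C\<^sup>*) \<Longrightarrow>
         (- 1) ^ card (V - {v}) * coeff r 1 < (0 :: rat)"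
      using less.hyps[OF lessC _ V'(1) contract_edge[OF E]] less.prems(1) by auto
    \<comment> \<open>The contraction has one vertex fewer, which compensates the minus sign in
      \<open>p - r\<close>: both contributions have the same sign.\<close>
    have sign: "(- 1) ^ card V * coeff (p - r) 1 =
        (- 1) ^ card V * coeff p 1 + (- 1) ^ card (V - {v}) * coeff r 1"
      by (simp add: V'(2) algebra_simps)
    have "poly (p - r) (of_nat q) = of_nat (card (colorings_below V E q))" for q
      using card_colorings_below_deletion_contraction[OF E less.prems(1), of q]
      by (simp add: p(1) r(1))
    moreover have "(- 1) ^ card V * coeff (p - r) 1 \<le> 0"
      unfolding sign using p(2) r(2) by simp
    moreover have "(- 1) ^ card V * coeff (p - r) 1 < 0"
      if conn: "\<forall>a\<in>V. \<forall>b\<in>V. (a, b) \<in> E\<^sup>*"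
    proof -
      have "(a, b) \<in> ?C\<^sup>*" if "a \<in> V - {v}" "b \<in> V - {v}" for a b
        using contract_edge_rtrancl[OF E, of a b] conn that by (auto simp: merge_def)
      with p(2) r(3) show ?thesis unfolding sign by (simp add: add_nonpos_neg)
    qed
    ultimately show ?thesis by blast
  qed
qed


section \<open>Evaluation at finitely many ones\<close>

text \<open>The value of the degree-n part of F when the first q variables are set to 1 and all
  others to 0; fixing the degree keeps the sum finite.\<close>

definition eval_ones :: "nat \<Rightarrow> nat \<Rightarrow> rat mvps \<Rightarrow> rat" where
  "eval_ones q n F = (\<Sum>m\<in>multisets_of_size {..<q} n. mvps_coeff F m)"

lemma eval_ones_times:
  assumes F: "homogeneous a F" and G: "homogeneous b G"
  shows "eval_ones q (a + b) (F * G) = eval_ones q a F * eval_ones q b G"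
proof -
  let ?B = "multisets_of_size {..<q}"
  let ?T = "?B a \<times> ?B b"
  let ?f = "\<lambda>(x, y). mvps_coeff F x * mvps_coeff G y"
  have fin: "finite (?B n)" for n
    by (rule finite_multisets_of_size) simp
  \<comment> \<open>By homogeneity only splittings into degrees a and b contribute. Grouping pairs
    by their product then turns the double sum into a sum over all of \<open>?T\<close>.\<close>
  have "(\<Sum>p | fst p + snd p = m. ?f p) = (\<Sum>p\<in>{p \<in> ?T. fst p + snd p = m}. ?f p)"
    if "m \<in> ?B (a + b)" for m
  proof (rule sum.mono_neutral_right)
    show "finite {p. fst p + snd p = m}"
      using finite_mset_splits[of m] by (simp add: case_prod_unfold)
    show "\<forall>p\<in>{p. fst p + snd p = m} - {p \<in> ?T. fst p + snd p = m}. ?f p = 0"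
    proof
      fix p assume p: "p \<in> {p. fst p + snd p = m} - {p \<in> ?T. fst p + snd p = m}"
      obtain x y where xy: "p = (x, y)" by (cases p)
      with p that have "set_mset x \<subseteq> {..<q}" "set_mset y \<subseteq> {..<q}"
        by (auto simp: multisets_of_size_def)
      with p xy have "size x \<noteq> a \<or> size y \<noteq> b"
        by (auto simp: multisets_of_size_def)
      with F G xy show "?f p = 0" by (auto simp: homogeneous_def)
    qed
  qed auto
  then have "eval_ones q (a + b) (F * G) =
      (\<Sum>m\<in>?B (a + b). \<Sum>p\<in>{p \<in> ?T. fst p + snd p = m}. ?f p)"
    by (simp add: eval_ones_def mvps_coeff_times case_prod_unfold)
  also have "\<dots> = (\<Sum>p\<in>?T. ?f p)"
    by (rule sum.group) (use fin in \<open>auto simp: multisets_of_size_def\<close>)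
  also have "\<dots> = eval_ones q a F * eval_ones q b G"
    by (simp add: eval_ones_def sum_product sum.cartesian_product)
  finally show ?thesis .
qed

text \<open>The surviving monomials correspond to the k-element subsets of the q remaining
  indices.\<close>

lemma eval_ones_elem_sym: "eval_ones q k (elem_sym k) = of_nat (q choose k)"
proof -
  let ?B = "multisets_of_size {..<q} k"
  have fin: "finite ?B" by (rule finite_multisets_of_size) simp
  have fin_sub: "finite S" if "S \<subseteq> {..<q}" for S :: "nat set"
    using that finite_subset by blast
  have "eval_ones q k (elem_sym k) = (\<Sum>m\<in>?B. if mset_set (set_mset m) = m then 1 else 0)"
    unfolding eval_ones_def
    by (intro sum.cong) (auto simp: mvps_coeff_elem_sym multisets_of_size_def)
  also have "\<dots> = of_nat (card {m \<in> ?B. mset_set (set_mset m) = m})"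
    using fin by (simp add: sum.If_cases Int_def)
  also have "bij_betw set_mset {m \<in> ?B. mset_set (set_mset m) = m} {S. S \<subseteq> {..<q} \<and> card S = k}"
  proof (rule bij_betw_byWitness[where f' = mset_set])
    show "set_mset ` {m \<in> ?B. mset_set (set_mset m) = m} \<subseteq> {S. S \<subseteq> {..<q} \<and> card S = k}"
    proof (intro image_subsetI CollectI)
      fix m assume m: "m \<in> {m \<in> ?B. mset_set (set_mset m) = m}"
      then have "card (set_mset m) = size m"
        by (metis (mono_tags, lifting) mem_Collect_eq size_mset_set)
      with m show "set_mset m \<subseteq> {..<q} \<and> card (set_mset m) = k"
        by (simp add: multisets_of_size_def)
    qed
    show "\<forall>S\<in>{S. S \<subseteq> {..<q} \<and> card S = k}. set_mset (mset_set S) = S"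
      by (simp add: fin_sub)
    show "mset_set ` {S. S \<subseteq> {..<q} \<and> card S = k} \<subseteq> {m \<in> ?B. mset_set (set_mset m) = m}"
      by (auto simp: multisets_of_size_def fin_sub)
  qed simp
  then have "card {m \<in> ?B. mset_set (set_mset m) = m} = q choose k"
    by (simp add: bij_betw_same_card n_subsets)
  finally show ?thesis .
qed

lemma eval_ones_elem_sym_part:
  "eval_ones q (\<Sum>\<^sub># \<mu>) (elem_sym_part \<mu>) = (\<Prod>k\<in>#\<mu>. of_nat (q choose k))"
proof (induction \<mu>)
  case empty
  have "multisets_of_size {..<q} 0 = {{#}}"
    by (auto simp: multisets_of_size_def)
  then show ?case by (simp add: eval_ones_def mvps_coeff_one)
next
  case (add k \<mu>)
  have "homogeneous k (elem_sym k)"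
    by (simp add: homogeneous_def mvps_coeff_elem_sym)
  from eval_ones_times[OF this homogeneous_elem_sym_part[of \<mu>], of q] add show ?case
    by (simp add: eval_ones_elem_sym)
qed

section \<open>Binomial coefficients as polynomials and their linear terms\<close>

fun binomial_poly :: "nat \<Rightarrow> rat poly" where
  "binomial_poly 0 = 1"
| "binomial_poly (Suc k) = smult (1 / of_nat (Suc k)) ([:- of_nat k, 1:] * binomial_poly k)"

text \<open>\<open>binomial_poly k\<close> is X (X - 1) ... (X - k + 1) / k!, and the generalized
  binomial coefficient obeys the same recursion.\<close>

lemma poly_binomial_poly: "poly (binomial_poly k) (of_nat q) = of_nat (q choose k)"
proof -
  have "poly (binomial_poly k) x = x gchoose k" for x
  proof (induction k)
    case (Suc k)
    then show ?case
      using gbinomial_mult_1[of x k] by (simp add: field_simps del: of_nat_Suc)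
  qed simp
  then show ?thesis by (simp add: binomial_gbinomial)
qed

lemma coeff_0_binomial_poly: "k > 0 \<Longrightarrow> coeff (binomial_poly k) 0 = 0"
proof (induction k)
  case (Suc k)
  then show ?case by (cases k) (auto simp: coeff_mult_0)
qed simp

lemma coeff_1_times:
  fixes p r :: "'a :: comm_semiring_1 poly"
  shows "coeff (p * r) 1 = coeff p 0 * coeff r 1 + coeff p 1 * coeff r 0"
  by (simp add: coeff_mult)

text \<open>Apart from the factor X, the constant terms -1, ..., -k multiply to (-1)^k k!, which is
  divided by (k + 1)!.\<close>

lemma coeff_1_binomial_poly: "coeff (binomial_poly (Suc k)) 1 = (- 1) ^ k / of_nat (Suc k)"
proof (induction k)
  case (Suc k)
  have "coeff (binomial_poly (Suc (Suc k))) 1 =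
        1 / of_nat (Suc (Suc k)) * (- of_nat (Suc k) * coeff (binomial_poly (Suc k)) 1)"
    by (simp only: binomial_poly.simps(2)[of "Suc k"] coeff_smult coeff_1_times
        coeff_0_binomial_poly zero_less_Suc) simp
  also have "\<dots> = (- 1) ^ Suc k / of_nat (Suc (Suc k))"
    unfolding Suc by (simp add: field_simps del: of_nat_Suc)
  finally show ?case .
qed simp

text \<open>Positive parts give factors without constant term, so two of them make the product
  divisible by X^2.\<close>

lemma coeff_1_prod_binomial_poly:
  assumes "is_partition \<mu>" and "size \<mu> \<ge> 2"
  shows "coeff (\<Prod>k\<in>#\<mu>. binomial_poly k) 1 = 0"
proof -
  from assms(2) obtain a b \<nu> where \<mu>: "\<mu> = add_mset a (add_mset b \<nu>)"
    by (metis One_nat_def Suc_1 Suc_le_D size_eq_Suc_imp_eq_union size_add_mset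
        Suc_le_mono)
  with assms(1) have "a > 0" "b > 0" by (auto simp: is_partition_def)
  then show ?thesis
    unfolding \<mu> by (simp add: coeff_1_times coeff_mult_0 coeff_0_binomial_poly del: One_nat_def)
qed

lemma poly_eq_of_nat:
  fixes p r :: "rat poly"
  assumes "\<And>q :: nat. poly p (of_nat q) = poly r (of_nat q)"
  shows "p = r"
proof (rule ccontr)
  assume "p \<noteq> r"
  then have "finite {x. poly (p - r) x = 0}" by (intro poly_roots_finite) simp
  moreover have "range of_nat \<subseteq> {x. poly (p - r) x = 0}" using assms by auto
  ultimately have "finite (range (of_nat :: nat \<Rightarrow> rat))" by (rule finite_subset[rotated])
  from finite_imageD[OF this inj_of_nat] show False by simp
qed


section \<open>The chromatic symmetric function\<close>

abbreviation coloring_monom :: "'v pair_pre_digraph \<Rightarrow> ('v \<Rightarrow> nat) \<Rightarrow> nat multiset" where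
  "coloring_monom G \<kappa> \<equiv> image_mset \<kappa> (mset_set (pverts G))"

lemma mvps_coeff_chromatic_sym:
  "mvps_coeff (chromatic_sym G) m =
     of_nat (card {\<kappa> \<in> proper_colorings G. coloring_monom G \<kappa> = m})"
  by (simp add: chromatic_sym_def mvps_coeff_monomial_sum)

lemma homogeneous_chromatic_sym: "homogeneous (card (pverts G)) (chromatic_sym G)"
  unfolding homogeneous_def
proof (intro allI impI)
  fix m assume "mvps_coeff (chromatic_sym G) m \<noteq> 0"
  then obtain \<kappa> where "coloring_monom G \<kappa> = m"
    by (auto simp: mvps_coeff_chromatic_sym card_eq_0_iff)
  then show "size m = card (pverts G)" by auto
qed

lemma coloring_monom_restrict:
  assumes "finite (pverts G)"
  shows "coloring_monom G (restrict f (pverts G)) = coloring_monom G f"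
  using assms by (intro image_mset_cong) simp

lemma count_coloring_monom:
  assumes "finite (pverts G)"
  shows "count (coloring_monom G \<kappa>) i = card {v \<in> pverts G. \<kappa> v = i}"
proof -
  have "count (coloring_monom G \<kappa>) i = (\<Sum>v\<in>{v \<in> pverts G. \<kappa> v = i}. 1)"
    unfolding count_image_mset' using assms by (intro sum.cong) auto
  then show ?thesis by simp
qed

context
  fixes G :: "'v pair_pre_digraph"
  assumes G: "pair_graph G"
begin

interpretation pair_graph G by (rule G)

text \<open>Permuting the colors is a bijection on proper colorings; \<open>restrict\<close> keeps
  the results extensional.\<close>

lemma symmetric_series_chromatic_sym: "symmetric_series (chromatic_sym G)"
  unfolding symmetric_series_def
proof (intro allI impI)
  fix \<pi> :: "nat \<Rightarrow> nat" and m
  assume "bij \<pi>"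
  let ?C = "\<lambda>m. {\<kappa> \<in> proper_colorings G. coloring_monom G \<kappa> = m}"
  let ?f = "\<lambda>\<pi> \<kappa>. restrict (\<pi> \<circ> \<kappa>) (pverts G)"
  have arcs: "u \<in> pverts G \<and> v \<in> pverts G" if "(u, v) \<in> parcs G" for u v
    using that in_arcsD1 in_arcsD2 by blast
  have maps: "?f \<sigma> \<kappa> \<in> ?C (image_mset \<sigma> m)" if "inj \<sigma>" "\<kappa> \<in> ?C m" for \<sigma> \<kappa> m
    using that arcs pair_finite_verts
    by (auto simp: proper_colorings_def coloring_monom_restrict inj_eq multiset.map_comp)
  have inv: "inv \<pi> (\<pi> x) = x" "\<pi> (inv \<pi> x) = x" for x
    using \<open>bij \<pi>\<close> by (simp_all add: bij_is_inj bij_is_surj surj_f_inv_f)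
  have "bij_betw (?f \<pi>) (?C m) (?C (image_mset \<pi> m))"
  proof (rule bij_betw_byWitness[where f' = "?f (inv \<pi>)"])
    show "?f \<pi> ` ?C m \<subseteq> ?C (image_mset \<pi> m)"
      using maps[of \<pi>] \<open>bij \<pi>\<close> by (blast dest: bij_is_inj)
    have "image_mset (inv \<pi>) (image_mset \<pi> m) = m"
      by (simp add: multiset.map_comp comp_def inv)
    then show "?f (inv \<pi>) ` ?C (image_mset \<pi> m) \<subseteq> ?C m"
      using maps[OF bij_is_inj[OF bij_imp_bij_inv[OF \<open>bij \<pi>\<close>]], of _ "image_mset \<pi> m"] by auto
  qed (auto simp: proper_colorings_def fun_eq_iff PiE_def extensional_def inv)
  from bij_betw_same_card[OF this]
  show "mvps_coeff (chromatic_sym G) (image_mset \<pi> m) = mvps_coeff (chromatic_sym G) m"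
    by (simp add: mvps_coeff_chromatic_sym)
qed

text \<open>Setting the other variables to 0 leaves exactly the colorings with colors below q, each
  counted once.\<close>

lemma eval_ones_chromatic_sym:
  "eval_ones q (card (pverts G)) (chromatic_sym G) =
     of_nat (card (colorings_below (pverts G) (parcs G) q))"
proof -
  let ?B = "multisets_of_size {..<q} (card (pverts G))"
  let ?K = "colorings_below (pverts G) (parcs G) q"
  have finK: "finite ?K" by (rule finite_colorings_below[OF pair_finite_verts])
  have finB: "finite ?B" by (rule finite_multisets_of_size) simp
  have sub: "coloring_monom G ` ?K \<subseteq> ?B"
    using pair_finite_verts by (auto simp: multisets_of_size_def colorings_below_def)
  have "{\<kappa> \<in> proper_colorings G. coloring_monom G \<kappa> = m} = {\<kappa> \<in> ?K. coloring_monom G \<kappa> = m}"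
    if "m \<in> ?B" for m
    using that pair_finite_verts
    by (auto simp: multisets_of_size_def colorings_below_def proper_colorings_def PiE_def
        image_subset_iff)
  then have "eval_ones q (card (pverts G)) (chromatic_sym G) =
      (\<Sum>m\<in>?B. \<Sum>\<kappa>\<in>{\<kappa> \<in> ?K. coloring_monom G \<kappa> = m}. 1)"
    by (simp add: eval_ones_def mvps_coeff_chromatic_sym)
  also have "\<dots> = (\<Sum>\<kappa>\<in>?K. 1)"
    by (rule sum.group[OF finK finB sub])
  finally show ?thesis by simp
qed

lemma chromatic_sym_e_expansion:
  obtains c where "is_e_expansion c (chromatic_sym G)"
    and "\<And>\<mu>. c \<mu> \<noteq> 0 \<Longrightarrow> \<Sum>\<^sub># \<mu> = card (pverts G)"
  using ex_e_expansion[OF symmetric_series_chromatic_sym homogeneous_chromatic_sym] by auto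

text \<open>
  Setting \<open>q\<close> variables to \<open>1\<close> turns an expansion \<open>\<Sum> c\<^sub>\<mu> e\<^sub>\<mu>\<close> into the polynomial
  \<open>\<Sum> c\<^sub>\<mu> \<Prod> binom(q, \<mu>\<^sub>i)\<close>, and each binomial is divisible by \<open>q\<close>: the linear coefficient
  sees only the one-part partition.
\<close>

lemma e_coeff_single_part_pos:
  assumes "connected (with_proj G)"
  shows "e_coeff {#card (pverts G)#} (chromatic_sym G) > 0"
proof -
  let ?V = "pverts G" and ?n = "card (pverts G)"
  have sym: "sym (parcs G)"
    using arcs_symmetric by (auto intro: symI)
  \<comment> \<open>\<open>connected\<close> refers to the symmetric closure, which changes nothing
    for symmetric arcs.\<close>
  have eq: "parcs (mk_symmetric (with_proj G)) = parcs G"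
    using adj_mk_symmetric_eq pair_sym_arcs by simp
  have reach: "(a, b) \<in> (parcs G)\<^sup>*" if "a \<in> ?V" "b \<in> ?V" for a b
    using assms that unfolding connected_def strongly_connected_def reachable_def
    by (auto simp: eq dest: rtrancl_on_rtranclI)
  have V: "?V \<noteq> {}"
    using assms unfolding connected_def strongly_connected_def by simp
  have irr: "irrefl (parcs G)"
    using pair_no_loops by (fastforce simp: irrefl_def)
  have sub: "parcs G \<subseteq> ?V \<times> ?V"
    using in_arcsD1 in_arcsD2 by auto
  obtain p :: "rat poly" where
    p: "\<And>q. poly p (of_nat q) = of_nat (card (colorings_below ?V (parcs G) q))"
    and neg: "(- 1) ^ ?n * coeff p 1 < 0"
    using chromatic_polynomial[OF pair_finite_verts V sub sym irr] reach by blast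
  obtain c where c: "is_e_expansion c (chromatic_sym G)"
    and supp: "\<And>\<mu>. c \<mu> \<noteq> 0 \<Longrightarrow> \<Sum>\<^sub># \<mu> = ?n"
    using chromatic_sym_e_expansion by blast
  \<comment> \<open>The one-part partition is inserted because its coefficient is not yet known to
    be nonzero.\<close>
  let ?A = "insert {#?n#} {\<mu>. c \<mu> \<noteq> 0}"
  have fin: "finite ?A" and part: "\<And>\<mu>. c \<mu> \<noteq> 0 \<Longrightarrow> is_partition \<mu>"
    using c by (auto simp: is_e_expansion_def)
  have supp_A: "\<Sum>\<^sub># \<mu> = ?n" if "\<mu> \<in> ?A" for \<mu>
    using that supp by auto
  have "p = (\<Sum>\<mu>\<in>?A. smult (c \<mu>) (\<Prod>k\<in>#\<mu>. binomial_poly k))"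
  proof (rule poly_eq_of_nat)
    fix q
    have "poly p (of_nat q) = eval_ones q ?n (chromatic_sym G)"
      by (simp add: p eval_ones_chromatic_sym)
    also have "\<dots> = (\<Sum>m\<in>multisets_of_size {..<q} ?n.
        \<Sum>\<mu>\<in>?A. c \<mu> * mvps_coeff (elem_sym_part \<mu>) m)"
      unfolding eval_ones_def by (intro sum.cong is_e_expansionD[OF c fin]) auto
    also have "\<dots> = (\<Sum>\<mu>\<in>?A. c \<mu> * eval_ones q ?n (elem_sym_part \<mu>))"
      unfolding eval_ones_def by (subst sum.swap) (simp add: sum_distrib_left)
    also have "\<dots> = (\<Sum>\<mu>\<in>?A. c \<mu> * (\<Prod>k\<in>#\<mu>. of_nat (q choose k)))"
      by (intro sum.cong refl) (metis supp_A eval_ones_elem_sym_part)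
    also have "\<dots> = poly (\<Sum>\<mu>\<in>?A. smult (c \<mu>) (\<Prod>k\<in>#\<mu>. binomial_poly k)) (of_nat q)"
      by (simp only: poly_sum poly_smult poly_prod_mset image_mset.compositionality comp_def
          poly_binomial_poly)
    finally show "poly p (of_nat q) = \<dots>" .
  qed
  then have "coeff p 1 = (\<Sum>\<mu>\<in>?A. c \<mu> * coeff (\<Prod>k\<in>#\<mu>. binomial_poly k) 1)"
    by (simp add: coeff_sum)
  also have "\<dots> = (\<Sum>\<mu>\<in>{{#?n#}}. c \<mu> * coeff (\<Prod>k\<in>#\<mu>. binomial_poly k) 1)"
  proof (rule sum.mono_neutral_right[OF fin])
    show "\<forall>\<mu>\<in>?A - {{#?n#}}. c \<mu> * coeff (\<Prod>k\<in>#\<mu>. binomial_poly k) 1 = 0"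
    proof
      fix \<mu> assume \<mu>: "\<mu> \<in> ?A - {{#?n#}}"
      then have sum: "\<Sum>\<^sub># \<mu> = ?n" by (intro supp_A) blast
      have "size \<mu> \<noteq> 0"
        using sum V pair_finite_verts by (metis card_0_eq size_eq_0_iff_empty sum_mset.empty)
      moreover have "size \<mu> \<noteq> 1"
      proof
        assume "size \<mu> = 1"
        then obtain a where "\<mu> = {#a#}" using size_1_singleton_mset by blast
        with sum \<mu> show False by simp
      qed
      ultimately have "size \<mu> \<ge> 2" by linarith
      with \<mu> part show "c \<mu> * coeff (\<Prod>k\<in>#\<mu>. binomial_poly k) 1 = 0"
        by (simp add: coeff_1_prod_binomial_poly del: One_nat_def)
    qed
  qed auto
  also have "\<dots> = c {#?n#} * coeff (binomial_poly ?n) 1" by simp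
  finally have lin: "coeff p 1 = c {#?n#} * coeff (binomial_poly ?n) 1" .
  obtain k where k: "?n = Suc k"
    using V pair_finite_verts by (metis card_eq_0_iff not0_implies_Suc)
  \<comment> \<open>The signs (-1)^n and (-1)^(n-1) combine to -1, so the negative quantity
    \<open>neg\<close> forces a positive coefficient.\<close>
  have "(- 1) ^ ?n * coeff p 1 = - (c {#?n#} / of_nat (Suc k))"
    unfolding lin k coeff_1_binomial_poly by simp
  with neg have "c {#?n#} > 0" by (simp add: zero_less_divide_iff)
  then show ?thesis by (simp add: e_coeff_eq[OF c])
qed

section \<open>Independent sets and exponents of monomials\<close>

lemma finite_independent_card: "finite {card S | S. independent_set G S}"
proof (rule finite_subset)
  show "{card S | S. independent_set G S} \<subseteq> {..card (pverts G)}"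
    using card_mono[OF pair_finite_verts] by (auto simp: independent_set_def)
qed simp

lemma independent_set_card_le:
  "independent_set G S \<Longrightarrow> card S \<le> independence_number G"
  unfolding independence_number_def by (rule Max_ge[OF finite_independent_card]) blast

lemma ex_maximum_independent_set:
  obtains S where "independent_set G S" and "card S = independence_number G"
proof -
  have "independent_set G {}" by (simp add: independent_set_def)
  then have "{card S | S. independent_set G S} \<noteq> {}" by blast
  from Max_in[OF finite_independent_card this] show ?thesis
    using that unfolding independence_number_def by auto
qed

text \<open>The exponent of a variable is the size of its color class, which is independent.\<close>

lemma mvps_coeff_chromatic_sym_eq_0:
  assumes "independence_number G < count m i"
  shows "mvps_coeff (chromatic_sym G) m = 0"
proof -
  have "coloring_monom G \<kappa> \<noteq> m" if "\<kappa> \<in> proper_colorings G" for \<kappa>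
  proof
    assume m: "coloring_monom G \<kappa> = m"
    let ?S = "{v \<in> pverts G. \<kappa> v = i}"
    have "independent_set G ?S"
      using that by (auto simp: independent_set_def proper_colorings_def)
    moreover have "count m i = card ?S"
      unfolding m[symmetric] by (rule count_coloring_monom[OF pair_finite_verts])
    ultimately show False
      using independent_set_card_le assms by fastforce
  qed
  then have "{\<kappa> \<in> proper_colorings G. coloring_monom G \<kappa> = m} = {}" by blast
  then show ?thesis by (simp only: mvps_coeff_chromatic_sym card.empty of_nat_0)
qed

text \<open>The monomial \<open>x\<^sub>0\<^sup>k x\<^sub>i x\<^sub>j \<dots>\<close> of the coloring with one color class \<open>S\<close> and all
  other vertices colored differently.\<close>

lemma mvps_coeff_chromatic_sym_pos:
  assumes "independent_set G S"
  obtains m where "count m 0 = card S" and "mvps_coeff (chromatic_sym G) m > 0"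
proof -
  obtain g :: "'v \<Rightarrow> nat" where g: "inj_on g (pverts G)"
    using finite_imp_inj_to_nat_seg[OF pair_finite_verts] by auto
  \<comment> \<open>\<open>Suc\<close> reserves color 0 for S.\<close>
  define \<kappa> where "\<kappa> = restrict (\<lambda>v. if v \<in> S then 0 else Suc (g v)) (pverts G)"
  define m where "m = coloring_monom G \<kappa>"
  have S: "S \<subseteq> pverts G" "\<And>u v. u \<in> S \<Longrightarrow> v \<in> S \<Longrightarrow> (u, v) \<notin> parcs G"
    using assms by (auto simp: independent_set_def)
  have neq: "\<kappa> u \<noteq> \<kappa> v" if "(u, v) \<in> parcs G" for u v
    using that S(2)[of u v] in_arcsD1[OF that] in_arcsD2[OF that] pair_no_loops[OF that]
    by (auto simp: \<kappa>_def inj_on_eq_iff[OF g])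
  have "\<kappa> \<in> pverts G \<rightarrow>\<^sub>E UNIV" by (simp add: \<kappa>_def)
  then have proper: "\<kappa> \<in> proper_colorings G"
    using neq by (auto simp: proper_colorings_def)
  have "{v \<in> pverts G. \<kappa> v = 0} = S"
    using S(1) by (auto simp: \<kappa>_def)
  then have "count m 0 = card S"
    by (simp add: m_def count_coloring_monom pair_finite_verts)
  \<comment> \<open>An infinite set would have \<open>card\<close> equal to 0. Here all colors occur
    in \<open>m\<close>, which leaves finitely many colorings.\<close>
  moreover have "finite {\<kappa> \<in> proper_colorings G. coloring_monom G \<kappa> = m}"
  proof (rule finite_subset)
    show "finite (pverts G \<rightarrow>\<^sub>E set_mset m)"
      using pair_finite_verts by (simp add: finite_PiE)
    show "{\<kappa> \<in> proper_colorings G. coloring_monom G \<kappa> = m} \<subseteq> pverts G \<rightarrow>\<^sub>E set_mset m"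
      using pair_finite_verts by (auto simp: proper_colorings_def PiE_def)
  qed
  then have "mvps_coeff (chromatic_sym G) m > 0"
    using proper by (auto simp: mvps_coeff_chromatic_sym m_def card_gt_0_iff)
  ultimately show ?thesis by (rule that)
qed

end

section \<open>Comparison of the independence numbers\<close>

theorem proposition3p1:
  fixes G :: "'v pair_pre_digraph" and H :: "'w pair_pre_digraph" and n :: nat
  assumes "pair_graph G" and "connected (with_proj G)" and "card (pverts G) = n"
    and "pair_graph H" and "connected (with_proj H)" and "card (pverts H) = n"
    and "G \<ge>\<^sub>e H"
  shows "independence_number G \<ge> independence_number H"
proof (rule ccontr)
  assume less: "\<not> independence_number H \<le> independence_number G"
  define r where "r = e_coeff {#card (pverts G)#} (chromatic_sym G) /
                      e_coeff {#card (pverts H)#} (chromatic_sym H)"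
  have "r > 0"
    unfolding r_def using assms by (intro divide_pos_pos e_coeff_single_part_pos)
  obtain S where "independent_set H S" "card S = independence_number H"
    using ex_maximum_independent_set[OF assms(4)] .
  then obtain m where "count m 0 = independence_number H"
      and H_pos: "mvps_coeff (chromatic_sym H) m > 0"
    using mvps_coeff_chromatic_sym_pos[OF assms(4)] by metis
  then have G_0: "mvps_coeff (chromatic_sym G) m = 0"
    using mvps_coeff_chromatic_sym_eq_0[OF assms(1), of m 0] less by simp
  obtain c where c: "is_e_expansion c (chromatic_sym G)"
    using chromatic_sym_e_expansion[OF assms(1)] .
  obtain d where d: "is_e_expansion d (chromatic_sym H)"
    using chromatic_sym_e_expansion[OF assms(4)] .
  define x where "x \<mu> = c \<mu> + (- r) * d \<mu>" for \<mu>
  have "X_e G H = chromatic_sym G + mvps_scale (- r) (chromatic_sym H)"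
    by (rule mvps_eqI) (simp add: X_e_def r_def)
  then have x: "is_e_expansion x (X_e G H)"
    using is_e_expansion_plus_scale[OF c d, of "- r"] by (simp add: x_def[abs_def])
  \<comment> \<open>\<open>e_positive\<close> speaks only about partitions; elsewhere
    \<open>x\<close> vanishes because it is an expansion.\<close>
  have "x \<mu> \<ge> 0" for \<mu>
    using assms(7) x
    by (cases "x \<mu> = 0") (auto simp: e_ge_def e_positive_def e_coeff_eq[OF x] is_e_expansion_def)
  then have "mvps_coeff (X_e G H) m \<ge> 0"
    using is_e_expansionD[OF x _ order_refl, of m] x mvps_coeff_elem_sym_part_nonneg
    by (auto simp: is_e_expansion_def intro!: sum_nonneg)
  moreover have "mvps_coeff (X_e G H) m < 0"
    using G_0 H_pos \<open>r > 0\<close> by (simp add: X_e_def flip: r_def)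
  ultimately show False by simp
qed

end
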